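(* Let $G=(V,E,w)$ be a connected, undirected, weighted multigraph with at least one edge and all edge weights $w(e)\ge1$, and suppose $G$ is a $\Phi$-expander. Let $\mathbf{W}$ be the diagonal matrix of weights, $\mathbf{L}=\mathbf{B}\mathbf{W}\mathbf{B}^\top$, and $\mathbf{A}_{\mathcal{E}}=\mathbf{W}\mathbf{B}^\top\mathbf{L}^+$. Then \[ \rho_\infty(\mathbf{A}_{\mathcal{E}})\le 3\cdot\frac{\ln(\mathrm{vol}(V))}{\Phi}. \]
   Context: $\mathbf{B}\in\mathbb{R}^{V\times E}$ is the edge-vertex incidence matrix w.r.t. an arbitrary edge orientation ($\mathbf{B}(u,e)=-1$ if $e=(u,v)$, $1$ if $e=(v,u)$, $0$ otherwise); $\mathbf{L}^+$ is the pseudo-inverse. $G$ is a $\Phi$-expander if $|\partial S|\ge\Phi\cdot\mathrm{vol}(S)$ for all $S\subseteq V$ with $\mathrm{vol}(S)\le\mathrm{vol}(V)/2$, where $|\partial S|$ is the total weight of edges with exactly one endpoint in $S$ and $\mathrm{vol}(S)$ is the sum of weighted degrees of vertices in $S$. A demand is $\boldsymbol{\chi}\in\mathbb{R}^V$ with $\mathbf{1}^\top\boldsymbol{\chi}=0$; a flow $\mathbf{f}\in\mathbb{R}^E$ routes it if $\mathbf{B}\mathbf{f}=\boldsymbol{\chi}$. The congestion of a multiset of flows $\{\mathbf{f}_1,\dots,\mathbf{f}_k\}$ is $\|\mathbf{W}^{-1}\sum_i|\mathbf{f}_i|\|_\infty$ ($|\cdot|$ entrywise); $\mathrm{opt}(D)$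 for a multiset of demands $D=\{\boldsymbol{\chi}_1,\dots,\boldsymbol{\chi}_k\}$ is the minimum congestion over multisets $\{\mathbf{f}_i\}$ with $\mathbf{B}\mathbf{f}_i=\boldsymbol{\chi}_i$. For a linear map $\mathbf{A}\in\mathbb{R}^{E\times V}$ with $\mathbf{B}\mathbf{A}\boldsymbol{\chi}=\boldsymbol{\chi}$ for all demands, $\rho_\infty(\mathbf{A})=\sup_D \|\mathbf{W}^{-1}\sum_i|\mathbf{A}\boldsymbol{\chi}_i|\|_\infty/\mathrm{opt}(D)$ over multisets of demands with $\mathrm{opt}(D)>0$. *)

theory Defs
  imports "HOL-Analysis.Analysis" "HOL-Library.Multiset" "HOL-Library.Extended_Real"
begin

text \<open>
  A weighted undirected multigraph has the vertex set \<^term>\<open>UNIV :: 'v::finite set\<close> and the edge set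
  \<^term>\<open>UNIV :: 'e::finite set\<close> (both nonempty, as types are). The maps \<open>s t :: 'e \<Rightarrow> 'v\<close> give the
  endpoints of an edge; reading \<open>e\<close> as the pair \<open>(s e, t e)\<close> is the arbitrary orientation used by
  the incidence matrix. Parallel edges and self-loops are allowed.
\<close>

definition graph_connected :: "('e \<Rightarrow> 'v) \<Rightarrow> ('e \<Rightarrow> 'v) \<Rightarrow> bool" where
  "graph_connected s t \<longleftrightarrow>
     (\<forall>u v. (u, v) \<in> (range (\<lambda>e. (s e, t e)) \<union> range (\<lambda>e. (t e, s e)))\<^sup>*)"

text \<open>A self-loop contributes its weight twice to the degree of its vertex.\<close>

definition wdeg :: "('e::finite \<Rightarrow> 'v) \<Rightarrow> ('e \<Rightarrow> 'v) \<Rightarrow> ('e \<Rightarrow> real) \<Rightarrow> 'v \<Rightarrow> real" where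
  "wdeg s t w u = (\<Sum>e | s e = u. w e) + (\<Sum>e | t e = u. w e)"

definition vol :: "('e::finite \<Rightarrow> 'v::finite) \<Rightarrow> ('e \<Rightarrow> 'v) \<Rightarrow> ('e \<Rightarrow> real) \<Rightarrow> 'v set \<Rightarrow> real" where
  "vol s t w S = (\<Sum>u\<in>S. wdeg s t w u)"

definition cut_weight :: "('e::finite \<Rightarrow> 'v) \<Rightarrow> ('e \<Rightarrow> 'v) \<Rightarrow> ('e \<Rightarrow> real) \<Rightarrow> 'v set \<Rightarrow> real" where
  "cut_weight s t w S = (\<Sum>e | (s e \<in> S) \<noteq> (t e \<in> S). w e)"

definition expander ::
  "('e::finite \<Rightarrow> 'v::finite) \<Rightarrow> ('e \<Rightarrow> 'v) \<Rightarrow> ('e \<Rightarrow> real) \<Rightarrow> real \<Rightarrow> bool" where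
  "expander s t w \<Phi> \<longleftrightarrow>
     (\<forall>S. vol s t w S \<le> vol s t w UNIV / 2 \<longrightarrow> cut_weight s t w S \<ge> \<Phi> * vol s t w S)"

text \<open>The column of a self-loop is zero.\<close>

definition incidence :: "('e::finite \<Rightarrow> 'v::finite) \<Rightarrow> ('e \<Rightarrow> 'v) \<Rightarrow> real^'e^'v" where
  "incidence s t =
     (\<chi> u e. if s e = t e then 0 else if u = s e then -1 else if u = t e then 1 else 0)"

definition weight_matrix :: "('e::finite \<Rightarrow> real) \<Rightarrow> real^'e^'e" where
  "weight_matrix w = (\<chi> e e'. if e = e' then w e else 0)"

definition laplacian ::
  "('e::finite \<Rightarrow> 'v::finite) \<Rightarrow> ('e \<Rightarrow> 'v) \<Rightarrow> ('e \<Rightarrow> real) \<Rightarrow> real^'v^'v" where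
  "laplacian s t w = incidence s t ** weight_matrix w ** transpose (incidence s t)"

text \<open>The Moore-Penrose pseudo-inverse, as the matrix satisfying the four Penrose equations.\<close>

definition pseudo_inverse :: "real^'n::finite^'m::finite \<Rightarrow> real^'m^'n" where
  "pseudo_inverse M = (THE X. M ** X ** M = M \<and> X ** M ** X = X \<and>
     transpose (M ** X) = M ** X \<and> transpose (X ** M) = X ** M)"

definition electrical_routing ::
  "('e::finite \<Rightarrow> 'v::finite) \<Rightarrow> ('e \<Rightarrow> 'v) \<Rightarrow> ('e \<Rightarrow> real) \<Rightarrow> real^'v^'e" where
  "electrical_routing s t w =
     weight_matrix w ** transpose (incidence s t) ** pseudo_inverse (laplacian s t w)"

definition is_demand :: "real^'v::finite \<Rightarrow> bool" where
  "is_demand d \<longleftrightarrow> (\<Sum>u\<in>UNIV. d $ u) = 0"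

definition congestion :: "('e::finite \<Rightarrow> real) \<Rightarrow> (real^'e) multiset \<Rightarrow> real" where
  "congestion w F = infnorm (matrix_inv (weight_matrix w) *v (\<Sum>f\<in>#F. \<bar>f\<bar>))"

text \<open>
  The equation between multisets says that the flows can be enumerated as \<open>f\<^sub>1, \<dots>, f\<^sub>k\<close> and the
  demands as \<open>\<chi>\<^sub>1, \<dots>, \<chi>\<^sub>k\<close> such that \<open>f\<^sub>i\<close> routes \<open>\<chi>\<^sub>i\<close>.
\<close>

definition opt_congestion ::
  "('e::finite \<Rightarrow> 'v::finite) \<Rightarrow> ('e \<Rightarrow> 'v) \<Rightarrow> ('e \<Rightarrow> real) \<Rightarrow> (real^'v) multiset \<Rightarrow> real" where
  "opt_congestion s t w D =
     Inf {congestion w F | F. image_mset (\<lambda>f. incidence s t *v f) F = D}"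

definition competitive_ratio ::
  "('e::finite \<Rightarrow> 'v::finite) \<Rightarrow> ('e \<Rightarrow> 'v) \<Rightarrow> ('e \<Rightarrow> real) \<Rightarrow> real^'v^'e \<Rightarrow> ereal" where
  "competitive_ratio s t w A =
     (SUP D \<in> {D. (\<forall>d\<in>#D. is_demand d) \<and> opt_congestion s t w D > 0}.
        ereal (congestion w (image_mset (\<lambda>d. A *v d) D) / opt_congestion s t w D))"

end

theory Submission
  imports Defs
begin

text \<open>
  By linearity and reciprocity it suffices to bound, for each edge \<open>g\<close>, the total variation
  \<open>\<Sum>\<^sub>e w(e) |p(t e) - p(s e)|\<close> of the potential \<open>p\<close> that drives one unit of current across \<open>g\<close>.
  Split at a weighted median of \<open>p\<close> and sweep a threshold \<open>x\<close> towards it from one side. Let \<open>C\<close> and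
  \<open>V\<close> be the cut weight and the volume of \<open>{p > x}\<close>, and let \<open>M\<close> be the total weight of the edges,
  each counted by the fraction of it lying above \<open>x\<close>. At most one unit of current crosses the cut, so
  Cauchy-Schwarz gives \<open>C\<^sup>2 \<le> - M'\<close>; expansion gives \<open>C \<ge> \<Phi> V \<ge> \<Phi> max 1 M\<close> unless \<open>C = 0\<close>. Hence
  \<open>C \<le> - M' / (\<Phi> max 1 M)\<close>, and integrating bounds the variation on either side by
  \<open>(1 + ln (vol V / 2)) / \<Phi>\<close>, which is at most \<open>3/2 ln (vol V) / \<Phi>\<close>.
\<close>

section \<open>A truncated logarithm\<close>

text \<open>The antiderivative of \<open>1 / max 1 y\<close> vanishing at \<open>0\<close>.\<close>

definition trunc_log :: "real \<Rightarrow> real" where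
  "trunc_log y = (if y \<le> 1 then y else 1 + ln y)"

text \<open>The density \<open>1 / max 1 y\<close> is nonincreasing, so its integral from
  \<open>y\<close> to \<open>z\<close> is at least the length times the value at the right end. This
  lets finitely many steps replace an integration.\<close>

lemma trunc_log_diff_ge:
  assumes "0 \<le> y" "y \<le> z"
  shows "(z - y) / max 1 z \<le> trunc_log z - trunc_log y"
proof -
  have aux: "1 - 1 / a \<le> ln a" if "a > 0" for a :: real
    using ln_le_minus_one[of "1 / a"] that by (simp add: ln_div)
  consider "z \<le> 1" | "1 < y" | "y \<le> 1" "1 < z" by linarith
  then show ?thesis
  proof cases
    case 1
    then show ?thesis using assms by (simp add: trunc_log_def)
  next
    case 2
    then show ?thesis using assms aux[of "z / y"]
      by (simp add: trunc_log_def ln_div diff_divide_distrib)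
  next
    case 3
    have "y * (1 - 1 / z) \<le> 1 * (1 - 1 / z)"
      using 3 by (intro mult_right_mono) auto
    also have "\<dots> \<le> ln z" using aux[of z] 3 by simp
    finally show ?thesis using 3
      by (simp add: trunc_log_def diff_divide_distrib right_diff_distrib)
  qed
qed

lemma trunc_log_mono:
  assumes "0 \<le> y" "y \<le> z"
  shows "trunc_log y \<le> trunc_log z"
proof -
  have "0 \<le> (z - y) / max 1 z" using assms by auto
  then show ?thesis using trunc_log_diff_ge[OF assms] by linarith
qed

section \<open>Volumes and cuts as sums over edges\<close>

lemma vol_eq_sum_edges:
  "vol s t w S = (\<Sum>e\<in>UNIV. w e * (of_bool (s e \<in> S) + of_bool (t e \<in> S)))"
proof -
  have end_sum: "(\<Sum>u\<in>S. \<Sum>e | r e = u. w e) = (\<Sum>e\<in>UNIV. w e * of_bool (r e \<in> S))"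
    for r :: "'a \<Rightarrow> 'b"
  proof -
    have "(\<Sum>u\<in>S. \<Sum>e | r e = u. w e) = (\<Sum>u\<in>S. \<Sum>e\<in>UNIV. w e * of_bool (r e = u))"
      by (intro sum.cong refl sum.mono_neutral_cong_left) auto
    also have "\<dots> = (\<Sum>e\<in>UNIV. \<Sum>u\<in>S. w e * of_bool (r e = u))"
      by (rule sum.swap)
    also have "\<dots> = (\<Sum>e\<in>UNIV. w e * of_bool (r e \<in> S))"
      by (intro sum.cong refl) (auto simp: of_bool_def if_distrib cong: if_cong)
    finally show ?thesis .
  qed
  show ?thesis
    unfolding vol_def wdeg_def sum.distrib end_sum by (simp add: distrib_left sum.distrib)
qed

lemma cut_weight_eq_sum_edges:
  "cut_weight s t w S = (\<Sum>e\<in>UNIV. w e * of_bool ((s e \<in> S) \<noteq> (t e \<in> S)))"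
  unfolding cut_weight_def by (intro sum.mono_neutral_cong_left) auto

lemma vol_UNIV: "vol s t w UNIV = 2 * (\<Sum>e\<in>UNIV. w e)"
  unfolding vol_eq_sum_edges sum_distrib_left by (intro sum.cong refl) simp

lemma vol_mono:
  assumes "\<And>e. 0 \<le> w e" "S \<subseteq> T"
  shows "vol s t w S \<le> vol s t w T"
  unfolding vol_eq_sum_edges
  by (intro sum_mono mult_left_mono add_mono) (use assms in auto)

section \<open>Sweeping a threshold through a potential\<close>

text \<open>Clamping the potentials from below at \<open>x\<close> keeps only the part of each edge
  above \<open>x\<close>; by the coarea formula this is the integral of the cut weight of
  \<open>{u. z < p u}\<close> over \<open>z \<ge> x\<close>.\<close>

definition sweep_length ::
  "('e::finite \<Rightarrow> 'v) \<Rightarrow> ('e \<Rightarrow> 'v) \<Rightarrow> ('e \<Rightarrow> real) \<Rightarrow> ('v \<Rightarrow> real) \<Rightarrow> real \<Rightarrow> real" where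
  "sweep_length s t w p x = (\<Sum>e\<in>UNIV. w e * \<bar>max (p (s e)) x - max (p (t e)) x\<bar>)"

text \<open>Edges with equal end potentials contribute \<open>0 / 0 = 0\<close>.\<close>

definition sweep_volume ::
  "('e::finite \<Rightarrow> 'v) \<Rightarrow> ('e \<Rightarrow> 'v) \<Rightarrow> ('e \<Rightarrow> real) \<Rightarrow> ('v \<Rightarrow> real) \<Rightarrow> real \<Rightarrow> real" where
  "sweep_volume s t w p x =
     (\<Sum>e\<in>UNIV. w e * (\<bar>max (p (s e)) x - max (p (t e)) x\<bar> / \<bar>p (s e) - p (t e)\<bar>))"

lemma truncated_diff_le: "\<bar>max a x - max b x\<bar> / \<bar>a - b\<bar> \<le> (1::real)"
  by (cases "a = b") (auto simp: divide_le_eq)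

lemma sweep_volume_le_vol:
  assumes "\<And>e. 0 \<le> w e"
  shows "sweep_volume s t w p x \<le> vol s t w {u. x < p u}"
  unfolding sweep_volume_def vol_eq_sum_edges
proof (intro sum_mono mult_left_mono)
  fix e
  show "\<bar>max (p (s e)) x - max (p (t e)) x\<bar> / \<bar>p (s e) - p (t e)\<bar>
      \<le> of_bool (s e \<in> {u. x < p u}) + of_bool (t e \<in> {u. x < p u})"
  \<comment> \<open>An edge touching the set is counted at least once in the volume, and its
    fraction is at most 1; an edge missing the set is clamped to length 0.\<close>
  proof (cases "x < p (s e) \<or> x < p (t e)")
    case True
    then have "1 \<le> (of_bool (s e \<in> {u. x < p u}) + of_bool (t e \<in> {u. x < p u}) :: real)"
      by auto
    then show ?thesis using truncated_diff_le by (rule order_trans[rotated])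
  qed auto
qed (rule assms)

lemma sweep_volume_le_weight:
  assumes "\<And>e. 0 \<le> w e"
  shows "sweep_volume s t w p x \<le> (\<Sum>e\<in>UNIV. w e)"
  unfolding sweep_volume_def
  by (intro sum_mono mult_left_le truncated_diff_le assms)

lemma sweep_volume_nonneg:
  assumes "\<And>e. 0 \<le> w e"
  shows "0 \<le> sweep_volume s t w p x"
  unfolding sweep_volume_def by (intro sum_nonneg mult_nonneg_nonneg) (use assms in auto)

text \<open>Makes both sweep functions affine between consecutive potentials, with slopes read off
  from the cut at \<open>x\<close>.\<close>

lemma truncated_diff_step:
  fixes a b x y :: real
  assumes "x < y" "a \<le> x \<or> y \<le> a" "b \<le> x \<or> y \<le> b"
  shows "\<bar>max a x - max b x\<bar> = \<bar>max a y - max b y\<bar> + (y - x) * of_bool ((x < a) \<noteq> (x < b))"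
  using assms by auto

text \<open>Cauchy-Schwarz after splitting \<open>w e\<close> into \<open>sqrt (w e / d)\<close> and
  \<open>sqrt (w e * d)\<close>, where \<open>d\<close> is the potential drop; \<open>flow\<close>
  bounds the second factor by 1. By \<open>neq\<close> no crossing edge has \<open>d = 0\<close>,
  where \<open>w e / 0 = 0\<close> would lose it.\<close>

lemma cut_weight_square_le:
  assumes w: "\<And>e. 0 \<le> w e"
    and neq: "\<And>e. (s e \<in> S) \<noteq> (t e \<in> S) \<Longrightarrow> p (s e) \<noteq> p (t e)"
    and flow: "(\<Sum>e | (s e \<in> S) \<noteq> (t e \<in> S). w e * \<bar>p (s e) - p (t e)\<bar>) \<le> 1"
  shows "(cut_weight s t w S)\<^sup>2 \<le> (\<Sum>e | (s e \<in> S) \<noteq> (t e \<in> S). w e / \<bar>p (s e) - p (t e)\<bar>)"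
    (is "_ \<le> ?Q")
proof -
  let ?E = "{e. (s e \<in> S) \<noteq> (t e \<in> S)}" and ?d = "\<lambda>e. \<bar>p (s e) - p (t e)\<bar>"
  have Q: "0 \<le> ?Q" by (intro sum_nonneg) (use w in auto)
  have "cut_weight s t w S = (\<Sum>e\<in>?E. sqrt (w e / ?d e) * sqrt (w e * ?d e))"
    unfolding cut_weight_def using w neq
    by (intro sum.cong refl) (auto simp flip: real_sqrt_mult)
  then have "(cut_weight s t w S)\<^sup>2
      \<le> (\<Sum>e\<in>?E. (sqrt (w e / ?d e))\<^sup>2) * (\<Sum>e\<in>?E. (sqrt (w e * ?d e))\<^sup>2)"
    by (simp only: Cauchy_Schwarz_ineq_sum)
  also have "\<dots> = ?Q * (\<Sum>e\<in>?E. w e * ?d e)"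
    using w by simp
  also have "\<dots> \<le> ?Q" by (rule mult_left_le[OF flow Q])
  finally show ?thesis .
qed

text \<open>Induction on the number of vertices above \<open>x\<close> takes the place of
  integrating: each step moves the threshold to the next higher potential.\<close>

lemma sweep_bound:
  fixes s t :: "'e::finite \<Rightarrow> 'v::finite"
  assumes w: "\<And>e. 1 \<le> w e"
    and \<Phi>: "0 < \<Phi>" and ex: "expander s t w \<Phi>"
    and half: "vol s t w {u. m < p u} \<le> vol s t w UNIV / 2"
    and flow: "\<And>x. (\<Sum>e | (x < p (s e)) \<noteq> (x < p (t e)). w e * \<bar>p (s e) - p (t e)\<bar>) \<le> 1"
    and "m \<le> x"
  shows "\<Phi> * sweep_length s t w p x \<le> trunc_log (sweep_volume s t w p x)"
  using \<open>m \<le> x\<close>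
proof (induction "card {u. x < p u}" arbitrary: x rule: less_induct)
  case less
  have w0: "0 \<le> w e" for e using w[of e] by linarith
  show ?case
  proof (cases "{u. x < p u} = {}")
    case True
    then have "max (p u) x = x" for u by (auto simp: not_less max_def)
    then show ?thesis by (simp add: sweep_length_def sweep_volume_def trunc_log_def)
  next
    case False
    let ?S = "{u. x < p u}"
    let ?T = "sweep_length s t w p" and ?M = "sweep_volume s t w p"
    \<comment> \<open>The cut is the same for all thresholds from \<open>x\<close> up to but
      excluding \<open>y\<close>. At \<open>y\<close> itself the vertices of potential
      \<open>y\<close> drop out, so the induction hypothesis applies.\<close>
    define y where "y = Min (p ` ?S)"
    define C where "C = cut_weight s t w ?S"
    define Q where "Q = (\<Sum>e | (s e \<in> ?S) \<noteq> (t e \<in> ?S). w e / \<bar>p (s e) - p (t e)\<bar>)"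
    have "y \<in> p ` ?S" unfolding y_def using False by (intro Min_in) auto
    then obtain u0 where u0: "x < p u0" "y = p u0" by auto
    then have xy: "x < y" by simp
    have gap: "p u \<le> x \<or> y \<le> p u" for u
      unfolding y_def by (cases "x < p u") (auto intro!: Min_le)
    have "{u. y < p u} \<subset> ?S" using u0 by auto
    then have IH: "\<Phi> * ?T y \<le> trunc_log (?M y)"
      using less xy by (intro less.hyps psubset_card_mono) auto
    have step: "\<bar>max (p (s e)) x - max (p (t e)) x\<bar> = \<bar>max (p (s e)) y - max (p (t e)) y\<bar>
        + (y - x) * of_bool ((s e \<in> ?S) \<noteq> (t e \<in> ?S))" for e
      using truncated_diff_step[OF xy gap gap] by simp
    have T: "?T x = ?T y + (y - x) * C"
      unfolding sweep_length_def C_def cut_weight_eq_sum_edges step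
        sum_distrib_left sum.distrib[symmetric]
      by (intro sum.cong refl) (simp only: algebra_simps)
    have Qeq: "Q = (\<Sum>e\<in>UNIV. w e * (of_bool ((s e \<in> ?S) \<noteq> (t e \<in> ?S)) / \<bar>p (s e) - p (t e)\<bar>))"
      unfolding Q_def by (intro sum.mono_neutral_cong_left) auto
    have M: "?M x = ?M y + (y - x) * Q"
      unfolding sweep_volume_def Qeq step
      by (simp add: distrib_left add_divide_distrib sum.distrib sum_distrib_left mult_ac)
    have "0 \<le> Q" unfolding Q_def by (intro sum_nonneg) (use w0 in auto)
    then have My: "0 \<le> ?M y" "?M y \<le> ?M x"
      using M xy by (simp_all add: sweep_volume_nonneg w0)
    have C2: "C\<^sup>2 \<le> Q" unfolding C_def Q_def
      using flow[of x] by (intro cut_weight_square_le w0) auto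
    show ?thesis
    proof (cases "\<exists>e. (s e \<in> ?S) \<noteq> (t e \<in> ?S)")
      case False
      then have "C = 0" unfolding C_def cut_weight_def by auto
      then show ?thesis using T IH trunc_log_mono[OF My] by simp
    next
      case True
      then obtain e where e: "(s e \<in> ?S) \<noteq> (t e \<in> ?S)" by blast
      \<comment> \<open>One crossing edge already has weight at least 1, so the cut and hence the
        volume are at least 1. This is the origin of the truncation in
        \<open>max 1 (?M x)\<close>.\<close>
      have "w e \<le> C" unfolding C_def cut_weight_def
        using e w0 by (intro member_le_sum) auto
      then have C1: "1 \<le> C" using w[of e] by linarith
      have "C \<le> vol s t w ?S"
        unfolding C_def cut_weight_eq_sum_edges vol_eq_sum_edges
        by (intro sum_mono mult_left_mono w0) auto
      then have max_le: "max 1 (?M x) \<le> vol s t w ?S"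
        using C1 sweep_volume_le_vol[of w s t p x] w0 by auto
      have "vol s t w ?S \<le> vol s t w {u. m < p u}"
        using less.prems by (intro vol_mono w0) auto
      then have "\<Phi> * vol s t w ?S \<le> C"
        using ex half unfolding expander_def C_def by auto
      then have CM: "\<Phi> * max 1 (?M x) \<le> C"
        using mult_left_mono[OF max_le, of \<Phi>] \<Phi> by linarith
      \<comment> \<open>Multiplying the expansion bound by \<open>C\<close> produces
        \<open>C * C\<close>, which is dominated by \<open>Q\<close>, the rate at which the sweep
        volume changes.\<close>
      have "\<Phi> * C * max 1 (?M x) \<le> C * C"
        using mult_right_mono[OF CM, of C] C1 by (simp add: mult_ac)
      also have "\<dots> \<le> Q" using C2 by (simp add: power2_eq_square)
      finally have "\<Phi> * C \<le> Q / max 1 (?M x)" by (simp add: pos_le_divide_eq)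
      then have "(y - x) * (\<Phi> * C) \<le> (y - x) * (Q / max 1 (?M x))"
        using xy by (intro mult_left_mono) auto
      also have "\<dots> = (?M x - ?M y) / max 1 (?M x)" using M by simp
      also have "\<dots> \<le> trunc_log (?M x) - trunc_log (?M y)"
        by (rule trunc_log_diff_ge[OF My])
      finally have "(y - x) * (\<Phi> * C) \<le> trunc_log (?M x) - trunc_log (?M y)" .
      moreover have "\<Phi> * ?T x = \<Phi> * ?T y + (y - x) * (\<Phi> * C)"
        by (simp add: T algebra_simps)
      ultimately show ?thesis using IH by linarith
    qed
  qed
qed

lemma sweep_length_bound:
  fixes s t :: "'e::finite \<Rightarrow> 'v::finite"
  assumes w: "\<And>e. 1 \<le> w e"
    and \<Phi>: "0 < \<Phi>" and ex: "expander s t w \<Phi>"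
    and half: "vol s t w {u. m < p u} \<le> vol s t w UNIV / 2"
    and flow: "\<And>x. (\<Sum>e | (x < p (s e)) \<noteq> (x < p (t e)). w e * \<bar>p (s e) - p (t e)\<bar>) \<le> 1"
  shows "sweep_length s t w p m \<le> 3 / 2 * (ln (vol s t w UNIV) / \<Phi>)"
proof -
  have w0: "0 \<le> w e" for e using w[of e] by linarith
  let ?W = "\<Sum>e\<in>UNIV. w e"
  \<comment> \<open>\<open>undefined\<close> serves as an arbitrary edge.\<close>
  have "w undefined \<le> ?W" by (intro member_le_sum) (use w0 in auto)
  then have W: "1 \<le> ?W" using w[of undefined] by linarith
  have "\<Phi> * sweep_length s t w p m \<le> trunc_log (sweep_volume s t w p m)"
    using sweep_bound[OF w \<Phi> ex half flow] by simp
  also have "\<dots> \<le> trunc_log ?W"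
    by (intro trunc_log_mono sweep_volume_nonneg sweep_volume_le_weight w0)
  also have "\<dots> \<le> 1 + ln ?W" using W by (auto simp: trunc_log_def)
  \<comment> \<open>From \<open>ln 2 \<ge> 2/3\<close> the additive 1 is at most
    \<open>3 / 2 * ln 2\<close>; this fixes the constant. The \<open>ln 2\<close> then turns the
    total weight into the volume.\<close>
  also have "\<dots> \<le> 3 / 2 * (ln 2 + ln ?W)"
    using ln2_ge_two_thirds ln_ge_zero[OF W] by (simp add: algebra_simps)
  also have "ln 2 + ln ?W = ln (vol s t w UNIV)"
    using W by (simp add: vol_UNIV ln_mult)
  finally show ?thesis using \<Phi> by (simp add: field_simps)
qed

section \<open>Splitting the variation at a weighted median\<close>

text \<open>Take the least potential with at most half the volume strictly above it. The next
  smaller potential \<open>y\<close> fails this test, so more than half lies above \<open>y\<close>,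
  and the vertices below \<open>m\<close> form the complement.\<close>

lemma weighted_median:
  fixes p :: "'v::finite \<Rightarrow> real"
  assumes "\<And>e. 0 \<le> w e"
  obtains m where "vol s t w {u. m < p u} \<le> vol s t w UNIV / 2"
    and "vol s t w {u. p u < m} \<le> vol s t w UNIV / 2"
proof -
  define P where "P = {x \<in> range p. vol s t w {u. x < p u} \<le> vol s t w UNIV / 2}"
  have vol_nonneg: "0 \<le> vol s t w UNIV"
    using vol_mono[OF assms, of "{}" UNIV] by (simp add: vol_def)
  have "Max (range p) \<in> range p" by (intro Max_in) auto
  moreover have "{u. Max (range p) < p u} = {}"
    using Max_ge[of "range p"] by (auto simp: not_less)
  ultimately have "Max (range p) \<in> P"
    unfolding P_def using vol_nonneg by (simp only: mem_Collect_eq) (simp add: vol_def)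
  then have P: "P \<noteq> {}" "finite P" by (blast, simp add: P_def)
  define m where "m = Min P"
  have m: "m \<in> P" unfolding m_def by (rule Min_in[OF P(2,1)])
  have "vol s t w {u. p u < m} \<le> vol s t w UNIV / 2"
  proof (cases "{u. p u < m} = {}")
    case True
    then show ?thesis using vol_nonneg by (simp add: vol_def)
  next
    case False
    define y where "y = Max (p ` {u. p u < m})"
    have "y \<in> p ` {u. p u < m}" unfolding y_def using False by (intro Max_in) auto
    then have y: "y \<in> range p" "y < m" by auto
    then have "y \<notin> P" using Min_le[OF P(2), of y] unfolding m_def by auto
    then have "vol s t w {u. y < p u} > vol s t w UNIV / 2" using y unfolding P_def by auto
    moreover have "{u. p u < m} = - {u. y < p u}"
      using y Max_ge[of "p ` {u. p u < m}"] by (fastforce simp: not_less simp flip: y_def)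
    moreover have "vol s t w UNIV = vol s t w S + vol s t w (- S)" for S
      unfolding vol_def by (subst sum.union_disjoint[symmetric]) auto
    ultimately show ?thesis by (smt (verit) field_sum_of_halves)
  qed
  then show ?thesis using m that unfolding P_def by blast
qed

lemma total_variation_bound:
  fixes s t :: "'e::finite \<Rightarrow> 'v::finite"
  assumes w: "\<And>e. 1 \<le> w e"
    and \<Phi>: "0 < \<Phi>" and ex: "expander s t w \<Phi>"
    and flow: "\<And>S. \<bar>\<Sum>e\<in>UNIV. w e * (p (t e) - p (s e)) * (of_bool (t e \<in> S) - of_bool (s e \<in> S))\<bar> \<le> 1"
  shows "(\<Sum>e\<in>UNIV. w e * \<bar>p (t e) - p (s e)\<bar>) \<le> 3 * (ln (vol s t w UNIV) / \<Phi>)"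
proof -
  have w0: "0 \<le> w e" for e using w[of e] by linarith
  obtain m where m: "vol s t w {u. m < p u} \<le> vol s t w UNIV / 2"
      "vol s t w {u. p u < m} \<le> vol s t w UNIV / 2"
    using weighted_median[of w s t p] w0 by blast
  \<comment> \<open>Every edge crossing a superlevel set has its higher end inside, so all signed
    terms are nonnegative and the net current is the total current.\<close>
  have flow_above: "(\<Sum>e | (x < p (s e)) \<noteq> (x < p (t e)). w e * \<bar>p (s e) - p (t e)\<bar>) \<le> 1" for x
  proof -
    have "(\<Sum>e | (x < p (s e)) \<noteq> (x < p (t e)). w e * \<bar>p (s e) - p (t e)\<bar>)
      = (\<Sum>e\<in>UNIV. w e * (p (t e) - p (s e))
          * (of_bool (t e \<in> {u. x < p u}) - of_bool (s e \<in> {u. x < p u})))"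
      by (intro sum.mono_neutral_cong_left) auto
    then show ?thesis using flow[of "{u. x < p u}"] by linarith
  qed
  have flow_below: "(\<Sum>e | (x < - p (s e)) \<noteq> (x < - p (t e)). w e * \<bar>- p (s e) - - p (t e)\<bar>) \<le> 1" for x
  proof -
    have "(\<Sum>e | (x < - p (s e)) \<noteq> (x < - p (t e)). w e * \<bar>- p (s e) - - p (t e)\<bar>)
      = - (\<Sum>e\<in>UNIV. w e * (p (t e) - p (s e))
          * (of_bool (t e \<in> {u. x < - p u}) - of_bool (s e \<in> {u. x < - p u})))"
      unfolding sum_negf[symmetric] by (intro sum.mono_neutral_cong_left) (auto simp: algebra_simps)
    then show ?thesis using flow[of "{u. x < - p u}"] by linarith
  qed
  \<comment> \<open>The part of an edge above \<open>m\<close> and, after negating the potential,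
    the part below \<open>m\<close> add up to its length; each side contributes half of the factor
    3.\<close>
  have "(\<Sum>e\<in>UNIV. w e * \<bar>p (t e) - p (s e)\<bar>)
      = sweep_length s t w p m + sweep_length s t w (\<lambda>u. - p u) (- m)"
    unfolding sweep_length_def sum.distrib[symmetric] distrib_left[symmetric]
    by (intro sum.cong refl arg_cong2[where f = "(*)"]) (auto simp: max_def)
  then show ?thesis
    using sweep_length_bound[OF w \<Phi> ex m(1) flow_above]
      sweep_length_bound[OF w \<Phi> ex, of "- m" "\<lambda>u. - p u", OF _ flow_below] m(2)
    by simp
qed

section \<open>Uniqueness of the pseudo-inverse\<close>

text \<open>For another solution \<open>Y\<close>, the products \<open>M ** X\<close> and
  \<open>M ** Y\<close> are symmetric and \<open>M ** X ** (M ** Y) = M ** Y\<close>; transposing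
  identifies them. Likewise on the other side, and then \<open>Y = Y ** M ** Y\<close> rewrites to
  \<open>X\<close>.\<close>

lemma pseudo_inverse_eqI:
  fixes M :: "real^'n^'m"
  assumes "M ** X ** M = M" "X ** M ** X = X"
    and "transpose (M ** X) = M ** X" "transpose (X ** M) = X ** M"
  shows "pseudo_inverse M = X"
  unfolding pseudo_inverse_def
proof (rule the_equality)
  fix Y :: "real^'m^'n"
  assume Y: "M ** Y ** M = M \<and> Y ** M ** Y = Y \<and>
    transpose (M ** Y) = M ** Y \<and> transpose (Y ** M) = Y ** M"
  have "M ** Y = transpose (M ** X ** (M ** Y))"
    using Y assms(1) by (simp add: matrix_mul_assoc)
  also have "\<dots> = M ** X"
    using Y assms(3) by (metis matrix_transpose_mul matrix_mul_assoc)
  finally have left: "M ** Y = M ** X" .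
  have "Y ** M = transpose ((Y ** M) ** (X ** M))"
    using Y assms(1) by (metis matrix_mul_assoc)
  also have "\<dots> = X ** M"
    using Y assms(4) by (metis matrix_transpose_mul matrix_mul_assoc)
  finally have right: "Y ** M = X ** M" .
  have "Y = Y ** M ** Y" using Y by simp
  also have "\<dots> = X ** (M ** Y)" by (simp add: right matrix_mul_assoc)
  also have "\<dots> = X" using assms(2) by (simp add: left matrix_mul_assoc)
  finally show "Y = X" .
qed (use assms in blast)

section \<open>Incidence matrix and Laplacian as operators\<close>

lemma vector_incidence_nth: "(y v* incidence s t) $ e = y $ t e - y $ s e"
proof (cases "s e = t e")
  case False
  have "(y v* incidence s t) $ e
      = (\<Sum>u\<in>UNIV. (of_bool (u = t e) - of_bool (u = s e)) * y $ u)"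
    using False unfolding vector_matrix_mult_def incidence_def
    by (auto intro!: sum.cong)
  then show ?thesis
    by (simp add: left_diff_distrib sum_subtractf of_bool_def if_distrib[of "\<lambda>c. c * _"] cong: if_cong)
qed (simp add: vector_matrix_mult_def incidence_def)

text \<open>Discrete divergence theorem: pair with the indicator of \<open>S\<close> and move the
  incidence matrix onto it, where it takes differences along edges.\<close>

lemma sum_incidence:
  "(\<Sum>u\<in>S. (incidence s t *v f) $ u) = (\<Sum>e\<in>UNIV. f $ e * (of_bool (t e \<in> S) - of_bool (s e \<in> S)))"
proof -
  have "(\<Sum>u\<in>S. (incidence s t *v f) $ u) = (\<chi> u. of_bool (u \<in> S)) \<bullet> (incidence s t *v f)"
    unfolding inner_vec_def by (intro sum.mono_neutral_cong_left) auto
  also have "\<dots> = ((\<chi> u. of_bool (u \<in> S)) v* incidence s t) \<bullet> f"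
    by (simp add: dot_lmul_matrix)
  finally show ?thesis
    by (simp add: inner_vec_def[of _ f] vector_incidence_nth mult.commute)
qed

lemma weight_matrix_nth: "(weight_matrix w *v f) $ e = w e * f $ e"
  by (simp add: weight_matrix_def matrix_vector_mult_def if_distrib[of "\<lambda>c. c * _"] cong: if_cong)

lemma laplacian_mult:
  "laplacian s t w *v y = incidence s t *v (\<chi> e. w e * (y $ t e - y $ s e))"
proof -
  have "weight_matrix w *v (transpose (incidence s t) *v y) = (\<chi> e. w e * (y $ t e - y $ s e))"
    by (simp add: vec_eq_iff weight_matrix_nth vector_incidence_nth)
  then show ?thesis
    unfolding laplacian_def by (simp flip: matrix_vector_mul_assoc)
qed

lemma inner_laplacian:
  "z \<bullet> (laplacian s t w *v y) = (\<Sum>e\<in>UNIV. w e * (z $ t e - z $ s e) * (y $ t e - y $ s e))"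
proof -
  have "z \<bullet> (laplacian s t w *v y)
      = (z v* incidence s t) \<bullet> (\<chi> e. w e * (y $ t e - y $ s e))"
    by (simp add: laplacian_mult dot_lmul_matrix)
  also have "\<dots> = (\<Sum>e\<in>UNIV. w e * (z $ t e - z $ s e) * (y $ t e - y $ s e))"
    by (simp add: inner_vec_def vector_incidence_nth mult_ac)
  finally show ?thesis .
qed

lemma transpose_laplacian: "transpose (laplacian s t w) = laplacian s t w"
proof -
  have "transpose (weight_matrix w) = weight_matrix w"
    by (auto simp: weight_matrix_def transpose_def vec_eq_iff)
  then show ?thesis
    by (simp add: laplacian_def matrix_transpose_mul matrix_mul_assoc)
qed

section \<open>Kernel and pseudo-inverse of the Laplacian\<close>

lemma connected_const:
  assumes "graph_connected s t" "\<And>e. y (s e) = y (t e)"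
  shows "y u = y v"
proof -
  have "(u, v) \<in> (range (\<lambda>e. (s e, t e)) \<union> range (\<lambda>e. (t e, s e)))\<^sup>*"
    using assms(1) unfolding graph_connected_def by blast
  then show ?thesis by (induction rule: rtrancl_induct) (use assms(2) in auto)
qed

text \<open>The orthogonal projection onto the constant vectors, which form the kernel of the
  Laplacian of a connected graph with positive weights.\<close>

definition mean_matrix :: "real^'n^'n" where
  "mean_matrix = (\<chi> i j. 1 / real CARD('n))"

lemma mean_matrix_nth: "(mean_matrix *v (y::real^'n)) $ i = (\<Sum>j\<in>UNIV. y $ j) / real CARD('n)"
  by (simp add: mean_matrix_def matrix_vector_mult_def sum_divide_distrib)

lemma transpose_mean_matrix: "transpose mean_matrix = mean_matrix"
  by (simp add: mean_matrix_def transpose_def)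

lemma mean_matrix_idem: "mean_matrix ** mean_matrix = (mean_matrix :: real^'n^'n)"
  by (simp add: mean_matrix_def matrix_matrix_mult_def vec_eq_iff)

lemma laplacian_mean_matrix: "laplacian s t w ** mean_matrix = 0"
proof -
  have "laplacian s t w *v (mean_matrix *v y) = 0" for y
  proof -
    have "(\<chi> e. w e * ((mean_matrix *v y) $ t e - (mean_matrix *v y) $ s e)) = 0"
      by (simp add: vec_eq_iff mean_matrix_nth)
    then show ?thesis unfolding laplacian_mult by simp
  qed
  then show ?thesis by (simp add: matrix_eq matrix_vector_mul_assoc)
qed

lemma mean_matrix_laplacian: "mean_matrix ** laplacian s t w = 0"
proof -
  have "transpose (laplacian s t w ** mean_matrix) = 0"
    by (simp add: laplacian_mean_matrix transpose_def vec_eq_iff)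
  then show ?thesis
    by (simp add: matrix_transpose_mul transpose_laplacian transpose_mean_matrix)
qed

text \<open>Pairing with \<open>y\<close> gives the Dirichlet energy plus a multiple of the squared
  sum of \<open>y\<close>, so both vanish. Zero energy and connectivity make \<open>y\<close>
  constant, and zero sum makes the constant 0.\<close>

lemma laplacian_plus_mean_ker:
  fixes s t :: "'e::finite \<Rightarrow> 'v::finite"
  assumes conn: "graph_connected s t" and w: "\<And>e. 0 < w e"
    and zero: "(laplacian s t w + mean_matrix) *v y = 0"
  shows "y = 0"
proof -
  let ?m = "\<Sum>u\<in>UNIV. y $ u"
  have "y \<bullet> (mean_matrix *v y) = ?m * ?m / real CARD('v)"
    by (simp add: inner_vec_def mean_matrix_nth flip: sum_distrib_right sum_divide_distrib)
  then have eq: "(\<Sum>e\<in>UNIV. w e * (y $ t e - y $ s e)\<^sup>2) + ?m * ?m / real CARD('v) = 0"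
    using arg_cong[OF zero, of "\<lambda>z. y \<bullet> z"]
    by (simp add: matrix_vector_mult_add_rdistrib inner_add_right inner_laplacian power2_eq_square mult.assoc)
  have nonneg: "0 \<le> w e * (y $ t e - y $ s e)\<^sup>2" for e
    using w[of e] by simp
  have "0 \<le> ?m * ?m / real CARD('v)" by simp
  then have "(\<Sum>e\<in>UNIV. w e * (y $ t e - y $ s e)\<^sup>2) = 0" and m: "?m = 0"
    using eq sum_nonneg[of UNIV "\<lambda>e. w e * (y $ t e - y $ s e)\<^sup>2", OF nonneg]
    by (smt (verit), simp add: add_nonneg_eq_0_iff)
  then have "w e * (y $ t e - y $ s e)\<^sup>2 = 0" for e
    using nonneg by (simp add: sum_nonneg_eq_0_iff)
  then have "y $ s e = y $ t e" for e
    by (metis w less_irrefl mult_eq_0_iff power_eq_0_iff eq_iff_diff_eq_0)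
  then have const: "y $ v = y $ u" for u v
    by (rule connected_const[OF conn])
  have "real CARD('v) * y $ u = 0" for u
  proof -
    have "?m = (\<Sum>v\<in>(UNIV :: 'v set). y $ u)" by (rule sum.cong[OF refl]) (rule const)
    then show ?thesis using m by simp
  qed
  then show ?thesis by (simp add: vec_eq_iff)
qed

text \<open>With \<open>P\<close> the projection onto the constants, the pseudo-inverse is \<open>(L + P)\<^sup>-\<^sup>1 - P\<close>.\<close>

lemma laplacian_pseudo_inverse:
  fixes s t :: "'e::finite \<Rightarrow> 'v::finite"
  assumes "graph_connected s t" "\<And>e. 0 < w e"
  defines "X \<equiv> pseudo_inverse (laplacian s t w)"
  shows "laplacian s t w ** X = mat 1 - mean_matrix" "transpose X = X"
proof -
  let ?L = "laplacian s t w" and ?P = "mean_matrix :: real^'v^'v"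
  obtain N where N: "N ** (?L + ?P) = mat 1"
    using matrix_left_invertible_ker[of "?L + ?P"] laplacian_plus_mean_ker[of s t w] assms(1,2) by blast
  then have N': "(?L + ?P) ** N = mat 1" by (simp add: matrix_left_right_inverse)
  have tr: "transpose (?L + ?P) = ?L + ?P"
    using transpose_laplacian[of s t w] transpose_mean_matrix[where 'a='v]
    by (simp add: vec_eq_iff transpose_def)
  have "transpose N = transpose N ** ((?L + ?P) ** N)" by (simp add: N')
  also have "\<dots> = transpose ((?L + ?P) ** N) ** N"
    by (simp add: matrix_transpose_mul tr matrix_mul_assoc)
  also have "\<dots> = N" by (simp add: N')
  finally have trN: "transpose N = N" .
  have sub_l: "A ** (B - C) = A ** B - A ** C" and sub_r: "(B - C) ** A = B ** A - C ** A"
    for A B C :: "real^'v^'v"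
    by (simp_all add: matrix_matrix_mult_def vec_eq_iff right_diff_distrib left_diff_distrib sum_subtractf)
  have add_r: "(B + C) ** A = B ** A + C ** A" for A B C :: "real^'v^'v"
    by (simp add: matrix_matrix_mult_def vec_eq_iff distrib_right sum.distrib)
  \<comment> \<open>\<open>?L + ?P\<close> fixes the constants, hence so does its inverse
    \<open>N\<close>; thus \<open>N ** (?L + ?P) = mat 1\<close> becomes
    \<open>N ** ?L = mat 1 - ?P\<close>.\<close>
  have LP: "(?L + ?P) ** ?P = ?P"
    by (simp add: add_r laplacian_mean_matrix mean_matrix_idem)
  have "N ** ?P = N ** ((?L + ?P) ** ?P)" by (simp add: LP)
  also have "\<dots> = ?P" by (simp add: matrix_mul_assoc N)
  finally have NP: "N ** ?P = ?P" .
  then have PN: "?P ** N = ?P"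
    by (metis matrix_transpose_mul trN transpose_mean_matrix)
  have NL: "N ** ?L = mat 1 - ?P" using N NP by (simp add: matrix_add_ldistrib eq_diff_eq)
  have LN: "?L ** N = mat 1 - ?P" using N' PN by (simp add: add_r eq_diff_eq)
  have XL: "(N - ?P) ** ?L = mat 1 - ?P" by (simp add: sub_r NL mean_matrix_laplacian)
  have LX: "?L ** (N - ?P) = mat 1 - ?P" by (simp add: sub_l LN laplacian_mean_matrix)
  have tr1: "transpose (A - B) = transpose A - transpose B" for A B :: "real^'v^'v"
    by (simp add: transpose_def vec_eq_iff)
  have "X = N - ?P"
    unfolding X_def
  proof (rule pseudo_inverse_eqI)
    show "?L ** (N - ?P) ** ?L = ?L"
      by (simp add: LX sub_r mean_matrix_laplacian)
    show "(N - ?P) ** ?L ** (N - ?P) = N - ?P"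
      unfolding XL by (simp add: sub_r sub_l PN mean_matrix_idem)
  qed (simp_all add: LX XL tr1 transpose_mean_matrix)
  then show "?L ** X = mat 1 - ?P" "transpose X = X"
    by (simp_all add: LX tr1 trN transpose_mean_matrix)
qed

text \<open>A demand is orthogonal to the constants, so \<open>mat 1 - mean_matrix\<close> fixes
  it.\<close>

lemma laplacian_pseudo_inverse_demand:
  assumes "graph_connected s t" "\<And>e. 0 < w e" "is_demand d"
  shows "laplacian s t w *v (pseudo_inverse (laplacian s t w) *v d) = d"
proof -
  have "mean_matrix *v d = 0"
    using assms(3) by (simp add: vec_eq_iff mean_matrix_nth is_demand_def)
  then show ?thesis
    using laplacian_pseudo_inverse(1)[of s t w] assms(1,2)
    by (simp add: matrix_vector_mul_assoc matrix_vector_mult_diff_rdistrib)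
qed

section \<open>Electrical routing and reciprocity\<close>

lemma is_demand_incidence: "is_demand (incidence s t *v f)"
  unfolding is_demand_def sum_incidence by simp

lemma electrical_routing_mult:
  "electrical_routing s t w *v d
     = weight_matrix w *v (transpose (incidence s t) *v (pseudo_inverse (laplacian s t w) *v d))"
  unfolding electrical_routing_def by (simp flip: matrix_vector_mul_assoc)

lemma incidence_electrical_routing:
  assumes "graph_connected s t" "\<And>e. 0 < w e" "is_demand d"
  shows "incidence s t *v (electrical_routing s t w *v d) = d"
  using laplacian_pseudo_inverse_demand[OF assms]
  by (simp add: electrical_routing_mult laplacian_def flip: matrix_vector_mul_assoc)

text \<open>Reciprocity: since \<open>\<^bold>L\<^sup>+\<close> is symmetric, the current through \<open>g\<close> caused by \<open>f\<close> is read off the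
  potential that drives one unit of current across \<open>g\<close>.\<close>

lemma electrical_routing_reciprocity:
  assumes "graph_connected s t" "\<And>e. 0 < w e"
  defines "p \<equiv> \<lambda>g. pseudo_inverse (laplacian s t w) *v (incidence s t *v axis g 1)"
  shows "(electrical_routing s t w *v (incidence s t *v f)) $ g
    = w g * (\<Sum>e\<in>UNIV. (p g $ t e - p g $ s e) * f $ e)"
proof -
  let ?B = "incidence s t" and ?X = "pseudo_inverse (laplacian s t w)"
  have X: "transpose ?X = ?X" using laplacian_pseudo_inverse(2)[of s t w] assms(1,2) by blast
  have "(transpose ?B *v (?X *v (?B *v f))) $ g = ((?X *v (?B *v f)) v* ?B) \<bullet> axis g 1"
    by (simp add: inner_axis)
  also have "\<dots> = (?B *v axis g 1) \<bullet> (?X *v (?B *v f))"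
    unfolding dot_lmul_matrix by (rule inner_commute)
  also have "\<dots> = ((p g) v* ?B) \<bullet> f"
    unfolding p_def dot_lmul_matrix by (metis X dot_lmul_matrix transpose_matrix_vector)
  also have "\<dots> = (\<Sum>e\<in>UNIV. (p g $ t e - p g $ s e) * f $ e)"
    by (simp add: inner_vec_def vector_incidence_nth)
  finally show ?thesis by (simp add: electrical_routing_mult weight_matrix_nth)
qed

section \<open>Congestion edge by edge\<close>

lemma weight_matrix_inv_nth:
  assumes "\<And>e. w e \<noteq> 0"
  shows "(matrix_inv (weight_matrix w) *v f) $ e = f $ e / w e"
proof -
  have prod: "weight_matrix a ** weight_matrix b = weight_matrix (\<lambda>e. a e * b e)" for a b :: "'a \<Rightarrow> real"
    by (simp add: matrix_eq vec_eq_iff weight_matrix_nth flip: matrix_vector_mul_assoc)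
  have one: "weight_matrix (\<lambda>e::'a. 1) = mat 1"
    by (simp add: weight_matrix_def mat_def)
  \<comment> \<open>\<open>matrix_inv\<close> is defined by choice, so an inverse is exhibited
    first: the diagonal matrix of reciprocals.\<close>
  have "\<exists>A'. weight_matrix w ** A' = mat 1 \<and> A' ** weight_matrix w = mat 1"
    by (rule exI[of _ "weight_matrix (\<lambda>e. 1 / w e)"]) (simp add: prod one assms)
  then have "weight_matrix w ** matrix_inv (weight_matrix w) = mat 1"
    unfolding matrix_inv_def by (rule someI2_ex) blast
  then have "weight_matrix w *v (matrix_inv (weight_matrix w) *v f) = f"
    by (simp add: matrix_vector_mul_assoc)
  then have "w e * (matrix_inv (weight_matrix w) *v f) $ e = f $ e"
    by (metis weight_matrix_nth)
  then show ?thesis using assms[of e] by (simp add: field_simps)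
qed

lemma sum_abs_mset_nth: "(\<Sum>f\<in>#F. \<bar>f\<bar> :: real^'e) $ e = (\<Sum>f\<in>#F. \<bar>f $ e\<bar>)"
  by (induction F) (simp_all add: abs_vec_def)

lemma le_congestion:
  assumes "\<And>e. 0 < w e"
  shows "(\<Sum>f\<in>#F. \<bar>f $ e\<bar>) \<le> w e * congestion w F"
proof -
  have "\<bar>(matrix_inv (weight_matrix w) *v (\<Sum>f\<in>#F. \<bar>f\<bar>)) $ e\<bar> \<le> congestion w F"
    unfolding congestion_def by (rule component_le_infnorm_cart)
  moreover have "w e \<noteq> 0" for e using assms[of e] by simp
  ultimately have "(\<Sum>f\<in>#F. \<bar>f $ e\<bar>) / w e \<le> congestion w F"
    by (simp add: weight_matrix_inv_nth sum_abs_mset_nth del: abs_divide)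
  then show ?thesis using assms[of e] by (simp add: field_simps)
qed

lemma congestion_le:
  assumes "\<And>e. 0 < w e" "\<And>e. (\<Sum>f\<in>#F. \<bar>f $ e\<bar>) \<le> w e * c"
  shows "congestion w F \<le> c"
  unfolding congestion_def infnorm_cart
proof (rule cSup_least)
  have nz: "w e \<noteq> 0" for e using assms(1)[of e] by simp
  have "0 \<le> (\<Sum>f\<in>#F. \<bar>f $ e\<bar>)" for e by (induction F) auto
  then have "\<bar>(matrix_inv (weight_matrix w) *v (\<Sum>f\<in>#F. \<bar>f\<bar>)) $ e\<bar> \<le> c" for e
    using assms(1,2)[of e] by (simp add: weight_matrix_inv_nth[OF nz] sum_abs_mset_nth field_simps)
  then show "x \<le> c" if "x \<in> {\<bar>(matrix_inv (weight_matrix w) *v (\<Sum>f\<in>#F. \<bar>f\<bar>)) $ i\<bar> |i. i \<in> UNIV}" for x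
    using that by blast
qed auto

section \<open>Comparing the electrical routing with every other routing\<close>

text \<open>By conservation the net current into any \<open>S\<close> equals that of a single unit
  sent along \<open>g\<close>, so it is -1, 0 or 1, as \<open>total_variation_bound\<close>
  requires.\<close>

lemma electrical_potential_variation:
  fixes s t :: "'e::finite \<Rightarrow> 'v::finite"
  assumes conn: "graph_connected s t" and w: "\<And>e. 1 \<le> w e"
    and "0 < \<Phi>" "expander s t w \<Phi>"
  defines "p \<equiv> \<lambda>g. pseudo_inverse (laplacian s t w) *v (incidence s t *v axis g 1)"
  shows "(\<Sum>e\<in>UNIV. w e * \<bar>p g $ t e - p g $ s e\<bar>) \<le> 3 * (ln (vol s t w UNIV) / \<Phi>)"
proof (rule total_variation_bound[OF w assms(3,4)])
  fix S
  have w_pos: "0 < w e" for e using w[of e] by linarith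
  have "laplacian s t w *v p g = incidence s t *v axis g 1"
    unfolding p_def
    by (rule laplacian_pseudo_inverse_demand[OF conn w_pos is_demand_incidence])
  then have "(\<Sum>u\<in>S. (incidence s t *v (\<chi> e. w e * (p g $ t e - p g $ s e))) $ u)
      = (\<Sum>u\<in>S. (incidence s t *v axis g 1) $ u)"
    by (simp add: laplacian_mult)
  then have "(\<Sum>e\<in>UNIV. w e * (p g $ t e - p g $ s e) * (of_bool (t e \<in> S) - of_bool (s e \<in> S)))
      = (\<Sum>e\<in>UNIV. axis g 1 $ e * (of_bool (t e \<in> S) - of_bool (s e \<in> S)))"
    unfolding sum_incidence by simp
  also have "\<dots> = of_bool (t g \<in> S) - of_bool (s g \<in> S)"
    by (simp add: axis_def if_distrib[of "\<lambda>c. c * _"] cong: if_cong)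
  finally show "\<bar>\<Sum>e\<in>UNIV. w e * (p g $ t e - p g $ s e)
      * (of_bool (t e \<in> S) - of_bool (s e \<in> S))\<bar> \<le> 1"
    by auto
qed

text \<open>The demands are given as those routed by an arbitrary \<open>F\<close>, so the estimate
  holds against every competitor.\<close>

lemma congestion_electrical_routing_le:
  fixes s t :: "'e::finite \<Rightarrow> 'v::finite"
  assumes conn: "graph_connected s t" and w: "\<And>e. 1 \<le> w e"
    and \<Phi>: "0 < \<Phi>" "expander s t w \<Phi>"
  shows "congestion w (image_mset (\<lambda>d. electrical_routing s t w *v d)
             (image_mset (\<lambda>f. incidence s t *v f) F))
    \<le> 3 * (ln (vol s t w UNIV) / \<Phi>) * congestion w F"
proof (rule congestion_le)
  show w_pos: "0 < w e" for e using w[of e] by linarith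
  fix g
  let ?K = "3 * (ln (vol s t w UNIV) / \<Phi>)"
  define p where "p = pseudo_inverse (laplacian s t w) *v (incidence s t *v axis g 1)"
  let ?d = "\<lambda>e. \<bar>p $ t e - p $ s e\<bar>"
  have single: "\<bar>(electrical_routing s t w *v (incidence s t *v f)) $ g\<bar>
      \<le> w g * (\<Sum>e\<in>UNIV. ?d e * \<bar>f $ e\<bar>)" for f
    unfolding electrical_routing_reciprocity[OF conn w_pos] p_def[symmetric] abs_mult
    using w_pos[of g]
    by (auto intro!: mult_left_mono order_trans[OF sum_abs] simp: abs_mult)
  have "(\<Sum>f\<in>#F. \<bar>(electrical_routing s t w *v (incidence s t *v f)) $ g\<bar>)
      \<le> (\<Sum>f\<in>#F. w g * (\<Sum>e\<in>UNIV. ?d e * \<bar>f $ e\<bar>))"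
    by (rule sum_mset_mono) (rule single)
  also have "\<dots> = w g * (\<Sum>e\<in>UNIV. ?d e * (\<Sum>f\<in>#F. \<bar>f $ e\<bar>))"
    by (induction F) (simp_all add: distrib_left sum.distrib)
  \<comment> \<open>Charging each edge \<open>e\<close> at most \<open>w e\<close> times the
    congestion of \<open>F\<close> leaves the total variation of \<open>p\<close> as the other
    factor.\<close>
  also have "\<dots> \<le> w g * (\<Sum>e\<in>UNIV. ?d e * (w e * congestion w F))"
    using w_pos by (intro mult_left_mono sum_mono le_congestion) (auto simp: less_imp_le)
  also have "\<dots> = w g * ((\<Sum>e\<in>UNIV. w e * ?d e) * congestion w F)"
    unfolding sum_distrib_right
    by (rule arg_cong[where f = "\<lambda>x. w g * x"], rule sum.cong) (simp_all only: mult_ac)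
  also have "\<dots> \<le> w g * (?K * congestion w F)"
    unfolding p_def using w_pos[of g]
    by (intro mult_left_mono mult_right_mono electrical_potential_variation[OF conn w \<Phi>])
      (auto simp: congestion_def infnorm_pos_le)
  finally show "(\<Sum>f\<in>#image_mset (\<lambda>d. electrical_routing s t w *v d)
        (image_mset (\<lambda>f. incidence s t *v f) F). \<bar>f $ g\<bar>) \<le> w g * (?K * congestion w F)"
    by (simp add: image_mset.compositionality comp_def)
qed

theorem theorem3p1:
  fixes s t :: "'e::finite \<Rightarrow> 'v::finite"
    and w :: "'e \<Rightarrow> real"
    and \<Phi> :: real
  assumes "graph_connected s t"
    and "\<And>e. w e \<ge> 1"
    and "\<Phi> > 0"
    and "expander s t w \<Phi>"
  shows "competitive_ratio s t w (electrical_routing s t w)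
           \<le> ereal (3 * (ln (vol s t w UNIV) / \<Phi>))"
  unfolding competitive_ratio_def
proof (rule SUP_least)
  fix D :: "(real^'v) multiset"
  assume "D \<in> {D. (\<forall>d\<in>#D. is_demand d) \<and> opt_congestion s t w D > 0}"
  then have D: "\<And>d. d \<in># D \<Longrightarrow> is_demand d" and opt: "0 < opt_congestion s t w D" by auto
  let ?K = "3 * (ln (vol s t w UNIV) / \<Phi>)"
  let ?c = "congestion w (image_mset (\<lambda>d. electrical_routing s t w *v d) D)"
  let ?R = "{congestion w F | F. image_mset (\<lambda>f. incidence s t *v f) F = D}"
  have w_pos: "0 < w e" for e using assms(2)[of e] by linarith
  have "w undefined \<le> (\<Sum>e\<in>UNIV. w e)"
    using w_pos by (intro member_le_sum) (auto simp: less_imp_le)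
  then have "1 < vol s t w UNIV" using assms(2)[of undefined] by (simp add: vol_UNIV)
  \<comment> \<open>Positivity allows dividing by \<open>?K\<close>, which turns the congestion
    estimate into a lower bound on every competitor and hence on the infimum.\<close>
  then have K: "0 < ?K" using assms(3) by simp
  \<comment> \<open>The electrical flows themselves route \<open>D\<close>, so the infimum is over a
    nonempty set.\<close>
  have "image_mset (\<lambda>d. incidence s t *v (electrical_routing s t w *v d)) D = image_mset (\<lambda>d. d) D"
    by (intro image_mset_cong incidence_electrical_routing[OF assms(1) w_pos] D)
  then have "image_mset (\<lambda>f. incidence s t *v f)
      (image_mset (\<lambda>d. electrical_routing s t w *v d) D) = D"
    by (simp add: image_mset.compositionality comp_def)
  then have "?R \<noteq> {}" by blast
  moreover have "?c / ?K \<le> r" if "r \<in> ?R" for r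
    using that congestion_electrical_routing_le[OF assms] K
    by (auto simp only: pos_divide_le_eq mult.commute mem_Collect_eq)
  ultimately have "?c / ?K \<le> opt_congestion s t w D"
    unfolding opt_congestion_def by (rule cInf_greatest)
  then have "?c / opt_congestion s t w D \<le> ?K"
    using opt K by (simp only: pos_divide_le_eq mult.commute)
  then show "ereal (?c / opt_congestion s t w D) \<le> ereal ?K" by simp
qed

end
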